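(* A finite lattice has Property (SDC) if and only if it is a Boolean lattice. (A lattice $\mathbb{L}=(L,\land,\lor)$ is said to have Property (SDC) if the clone $[\land,\lor]$ on $L$ has Property (SDC).)
   Context: A Boolean lattice is a bounded distributive lattice in which every element has a complement. Let $A$ be a finite set with at least two elements (the underlying sets of the algebras considered are of this kind). An operation on $A$ is a map $f\colon A^n\to A$, where the arity $n$ is a positive integer; $\mathcal{O}_A$ is the set of all operations on $A$, and $F^{(n)}$ is the set of $n$-ary members of $F\subseteq\mathcal{O}_A$. A clone on $A$ is a set $C\subseteq\mathcal{O}_A$ that contains all projections and is closed under composition; $[F]$ is the least clone containing $F$ (the set of term operations of the algebra $(A,F)$). Operations $f\in\mathcal{O}_A^{(n)}$ and $g\in\mathcal{O}_A^{(m)}$ commute if $f(g(a_{11},\dots,a_{1m}),\dots,g(a_{n1},\dots,a_{nm}))=g(f(a_{11},\dots,a_{n1}),\dots,f(a_{1m},\dots,a_{nm}))$ for all $a_{ij}\in A$. The centralizer of $F\subseteq\mathcal{O}_A$ is $F^{\ast}=\{g\in\mathcal{O}_A : g \text{ commutes with every } f\in F\}$. A set $T\subseteq A^n$ is closed under a clone $D$ if for all $m\in\mathbb{N}$, $\mathbf{t}^{(1)},\dots,\mathbf{t}^{(m)}\in T$ and $f\in D^{(m)}$, the tuple obtained by applying $f$ componentwise to $\mathbf{t}^{(1)},\dots,\mathbf{t}^{(m)}$ is in $T$. For a clone $C$ on $A$, a system of $C$-equations is a finite set $\mathcal{E}=\{(f_1,g_1),\dots,(f_t,g_t)\}$ with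 $f_i,g_i\in C^{(n)}$ (all of the same arity $n$), and $\operatorname{Sol}(\mathcal{E})=\{\mathbf{a}\in A^n : f_i(\mathbf{a})=g_i(\mathbf{a}) \text{ for } i=1,\dots,t\}$. The clone $C$ has Property (SDC) if for all $n\in\mathbb{N}$ and all $T\subseteq A^n$ the following are equivalent: (a) there exists a system $\mathcal{E}$ of $C$-equations such that $T=\operatorname{Sol}(\mathcal{E})$; (b) the set $T$ is closed under $C^{\ast}$.
   Formalization: Property (SDC) is required only for nonempty T; the empty set is closed under every clone (arities are positive) but is never a solution set over a lattice clone, since constant tuples solve every system, so with T empty admitted no Boolean lattice would have (SDC). *)

theory Defs
  imports "HOL-Library.FuncSet"
begin

text \<open>
  The underlying set of an algebra is a type. The set of \<open>n\<close>-tuples over it is represented by the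
  lists of length \<open>n\<close>. An \<open>n\<close>-ary operation is a pair \<open>(n, f)\<close> whose second component is
  \<^const>\<open>undefined\<close> outside the \<open>n\<close>-tuples, so that operations with the same arity and the same
  values are equal.
\<close>

type_synonym 'a operation = "nat \<times> ('a list \<Rightarrow> 'a)"

definition tuples :: "nat \<Rightarrow> 'a list set" where
  "tuples n = {xs. length xs = n}"

definition all_operations :: "'a operation set" where
  "all_operations = {(n, f). 0 < n \<and> f \<in> extensional (tuples n)}"

definition nary :: "'a operation set \<Rightarrow> nat \<Rightarrow> ('a list \<Rightarrow> 'a) set" where
  "nary F n = {f. (n, f) \<in> F}"

definition projection :: "nat \<Rightarrow> nat \<Rightarrow> 'a list \<Rightarrow> 'a" where
  "projection n i = (\<lambda>xs\<in>tuples n. xs ! i)"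

definition composition :: "nat \<Rightarrow> ('a list \<Rightarrow> 'a) \<Rightarrow> ('a list \<Rightarrow> 'a) list \<Rightarrow> 'a list \<Rightarrow> 'a" where
  "composition n f gs = (\<lambda>xs\<in>tuples n. f (map (\<lambda>g. g xs) gs))"

definition is_clone :: "'a operation set \<Rightarrow> bool" where
  "is_clone C \<longleftrightarrow>
     C \<subseteq> all_operations \<and>
     (\<forall>n. \<forall>i<n. (n, projection n i) \<in> C) \<and>
     (\<forall>m n f gs. f \<in> nary C m \<longrightarrow> length gs = m \<longrightarrow> set gs \<subseteq> nary C n
        \<longrightarrow> (n, composition n f gs) \<in> C)"

definition clone_generated :: "'a operation set \<Rightarrow> 'a operation set" where
  "clone_generated F = \<Inter>{C. is_clone C \<and> F \<subseteq> C}"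

text \<open>The matrix entry \<open>a i j\<close> is used for \<open>i < n\<close> and \<open>j < m\<close>, with indices starting at 0.\<close>

definition commutes :: "'a operation \<Rightarrow> 'a operation \<Rightarrow> bool" where
  "commutes = (\<lambda>(n, f) (m, g). \<forall>a :: nat \<Rightarrow> nat \<Rightarrow> 'a.
     f (map (\<lambda>i. g (map (\<lambda>j. a i j) [0..<m])) [0..<n]) =
     g (map (\<lambda>j. f (map (\<lambda>i. a i j) [0..<n])) [0..<m]))"

definition centralizer :: "'a operation set \<Rightarrow> 'a operation set" where
  "centralizer F = {g \<in> all_operations. \<forall>f\<in>F. commutes g f}"

definition closed_under :: "nat \<Rightarrow> 'a list set \<Rightarrow> 'a operation set \<Rightarrow> bool" where
  "closed_under n T D \<longleftrightarrow>
     (\<forall>m ts f. length ts = m \<longrightarrow> set ts \<subseteq> T \<longrightarrow> f \<in> nary D m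
        \<longrightarrow> map (\<lambda>i. f (map (\<lambda>t. t ! i) ts)) [0..<n] \<in> T)"

definition equation_system ::
  "'a operation set \<Rightarrow> nat \<Rightarrow> (('a list \<Rightarrow> 'a) \<times> ('a list \<Rightarrow> 'a)) set \<Rightarrow> bool" where
  "equation_system C n E \<longleftrightarrow> finite E \<and> E \<subseteq> nary C n \<times> nary C n"

definition Sol :: "nat \<Rightarrow> (('a list \<Rightarrow> 'a) \<times> ('a list \<Rightarrow> 'a)) set \<Rightarrow> 'a list set" where
  "Sol n E = {a \<in> tuples n. \<forall>(f, g)\<in>E. f a = g a}"

text \<open>
  Only nonempty sets \<open>T\<close> are considered. Since all arities are positive, the empty set is closed under
  every clone, while a system of equations over a clone of idempotent operations (such as the clone
  of a lattice) is solved by all constant tuples. Admitting \<open>T = {}\<close> would therefore make the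
  property fail for every lattice, including the Boolean ones.
\<close>

definition SDC :: "'a operation set \<Rightarrow> bool" where
  "SDC C \<longleftrightarrow>
     (\<forall>n>0. \<forall>T\<subseteq>tuples n. T \<noteq> {} \<longrightarrow>
        ((\<exists>E. equation_system C n E \<and> T = Sol n E) \<longleftrightarrow> closed_under n T (centralizer C)))"

definition meet_op :: "'a::lattice operation" where
  "meet_op = (2, \<lambda>xs\<in>tuples 2. inf (xs ! 0) (xs ! 1))"

definition join_op :: "'a::lattice operation" where
  "join_op = (2, \<lambda>xs\<in>tuples 2. sup (xs ! 0) (xs ! 1))"

definition lattice_SDC :: "'a::lattice itself \<Rightarrow> bool" where
  "lattice_SDC _ \<longleftrightarrow> SDC (clone_generated {meet_op, join_op :: 'a operation})"

text \<open>
  The class predicates are used because being bounded, distributive and complemented is here a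
  property of a given lattice. The class \<^class>\<open>boolean_algebra\<close> would make the bounds and the
  complementation part of the structure.
\<close>

definition boolean_lattice :: "'a::lattice itself \<Rightarrow> bool" where
  "boolean_lattice _ \<longleftrightarrow>
     class.distrib_lattice (inf :: 'a \<Rightarrow> 'a \<Rightarrow> 'a) (\<le>) (<) sup \<and>
     (\<exists>zero one. class.bounded_lattice (inf :: 'a \<Rightarrow> 'a \<Rightarrow> 'a) (\<le>) (<) sup zero one \<and>
        (\<forall>x. \<exists>y. inf x y = zero \<and> sup x y = one))"

end

theory Submission
  imports Defs
begin

text \<open>
  The \<open>m\<close>-ary members of the centralizer are the lattice homomorphisms \<open>L\<^sup>m \<rightarrow> L\<close>, so every set defined
  by a primitive positive formula over the lattice operations is closed under it.

  If (SDC) holds, such a set is determined by the equations it satisfies, and these can be transferred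
  between isomorphic chains, or from the factors of a subdirect product to the product. Transferring
  \<open>\<exists>a b. y \<sqinter> a = x \<and> y \<sqinter> b = x \<and> y \<le> a \<squnion> b\<close> from a pair \<open>x < y\<close> to \<open>0 < 1\<close> shows that it forces
  \<open>x = y\<close>; transferring \<open>\<exists>u. u \<sqinter> y = x \<and> u \<squnion> y = z\<close> from \<open>(0, 0, v)\<close> and \<open>(0, v, v)\<close> to \<open>(0, w, v)\<close>
  gives complements in the intervals \<open>[0, v]\<close>. A complement of \<open>(x \<sqinter> z) \<squnion> (y \<sqinter> z)\<close> in
  \<open>[0, (x \<squnion> y) \<sqinter> z]\<close> is disjoint from \<open>x\<close> and \<open>y\<close>, hence \<open>0\<close>, which is distributivity.

  Conversely, in a Boolean lattice a homomorphism \<open>L\<^sup>m \<rightarrow> L\<close> may be prescribed atom by atom. If \<open>a\<close> is not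
  in the closed set \<open>T\<close>, then for some atom \<open>p\<close> the truth values of \<open>p \<le> a\<^sub>k\<close> are not the image of any
  \<open>t \<in> T\<close> under any homomorphism to \<open>{False, True}\<close>. With \<open>I = {k. p \<le> a\<^sub>k}\<close>, the inequality
  \<open>\<Sqinter>\<^sub>k\<^sub>\<in>\<^sub>I x\<^sub>k \<le> \<Squnion>\<^sub>k\<^sub>\<notin>\<^sub>I x\<^sub>k\<close> then holds on \<open>T\<close> and fails at \<open>a\<close>.
\<close>

section \<open>Clones and the relations they preserve\<close>

abbreviation lattice_clone :: "'a::lattice operation set" where
  "lattice_clone \<equiv> clone_generated {meet_op, join_op}"

lemma is_clone_clone_generated:
  assumes "F \<subseteq> all_operations"
  shows "is_clone (clone_generated F)"
proof -
  have all: "is_clone (all_operations :: 'a operation set)"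
    unfolding is_clone_def
  proof (intro conjI allI impI)
    show "(n, projection n i) \<in> all_operations" if "i < n" for n i
      using that by (auto simp: all_operations_def projection_def)
    \<comment> \<open>Since \<open>m\<close> is positive, \<open>gs\<close> has a member, and the
      arity \<open>n\<close> of that member is positive.\<close>
    show "(n, composition n f gs) \<in> all_operations"
      if "f \<in> nary all_operations m" "length gs = m" "set gs \<subseteq> nary all_operations n"
      for m n and f :: "'a list \<Rightarrow> 'a" and gs
      using that by (cases gs) (auto simp: all_operations_def nary_def composition_def)
  qed simp
  show ?thesis
    unfolding is_clone_def
  proof (intro conjI allI impI)
    show "clone_generated F \<subseteq> all_operations"
      using all assms unfolding clone_generated_def by blast
    show "(n, projection n i) \<in> clone_generated F" if "i < n" for n i
      using that unfolding clone_generated_def is_clone_def by blast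
    show "(n, composition n f gs) \<in> clone_generated F"
      if "f \<in> nary (clone_generated F) m" "length gs = m" "set gs \<subseteq> nary (clone_generated F) n"
      for m n f gs
      unfolding clone_generated_def
    proof (rule InterI)
      fix C assume "C \<in> {C. is_clone C \<and> F \<subseteq> C}"
      then have "is_clone C" and "clone_generated F \<subseteq> C"
        by (auto simp: clone_generated_def)
      moreover from this that have "f \<in> nary C m" "set gs \<subseteq> nary C n"
        by (auto simp: nary_def)
      ultimately show "(n, composition n f gs) \<in> C"
        using that(2) unfolding is_clone_def by blast
    qed
  qed
qed

lemma lattice_ops_in_all_operations: "{meet_op, join_op} \<subseteq> all_operations"
  by (auto simp: meet_op_def join_op_def all_operations_def)

lemma is_clone_lattice_clone: "is_clone lattice_clone"
  by (rule is_clone_clone_generated[OF lattice_ops_in_all_operations])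

lemma meet_op_in_clone: "meet_op \<in> lattice_clone"
  and join_op_in_clone: "join_op \<in> lattice_clone"
  by (auto simp: clone_generated_def)

text \<open>The polymorphisms of a relation \<open>R\<close> whose rows are functions on an
  arbitrary index type. For composition, the inner operations produce rows of \<open>R\<close>
  again, and \<open>f\<close> is applied to these.\<close>

lemma is_clone_polymorphisms:
  fixes R :: "('i \<Rightarrow> 'a) set"
  shows "is_clone {(n, f) \<in> all_operations. \<forall>rs. length rs = n \<longrightarrow> set rs \<subseteq> R \<longrightarrow>
           (\<lambda>i. f (map (\<lambda>r. r i) rs)) \<in> R}" (is "is_clone ?P")
  unfolding is_clone_def
proof (intro conjI allI impI)
  show "?P \<subseteq> all_operations" by auto
  show "(n, projection n i) \<in> ?P" if "i < n" for n i
    using that by (auto simp: all_operations_def projection_def tuples_def)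
  show "(n, composition n f gs) \<in> ?P"
    if f: "f \<in> nary ?P m" and len: "length gs = m" and gs: "set gs \<subseteq> nary ?P n" for m n f gs
  proof -
    have "n > 0"
      using that by (cases gs) (auto simp: all_operations_def nary_def)
    moreover have "(\<lambda>i. composition n f gs (map (\<lambda>r. r i) rs)) \<in> R"
      if rs: "length rs = n" "set rs \<subseteq> R" for rs
    proof -
      have "set (map (\<lambda>g i. g (map (\<lambda>r. r i) rs)) gs) \<subseteq> R"
        using gs rs by (auto simp: nary_def)
      moreover have "length (map (\<lambda>g i. g (map (\<lambda>r. r i) rs)) gs) = m"
        using len by simp
      ultimately have "(\<lambda>i. f (map (\<lambda>r. r i) (map (\<lambda>g i. g (map (\<lambda>r. r i) rs)) gs))) \<in> R"
        using f unfolding nary_def by blast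
      then show ?thesis
        using rs by (simp add: composition_def tuples_def o_def)
    qed
    ultimately show ?thesis
      by (auto simp: all_operations_def composition_def)
  qed
qed

text \<open>The polymorphisms of \<open>R\<close> form a clone, so it is enough that they include
  both generators. This stands in for induction on lattice terms.\<close>

lemma lattice_clone_preserves:
  fixes R :: "('i \<Rightarrow> 'a::lattice) set"
  assumes f: "f \<in> nary lattice_clone n"
    and "\<And>r s. r \<in> R \<Longrightarrow> s \<in> R \<Longrightarrow> inf r s \<in> R"
    and "\<And>r s. r \<in> R \<Longrightarrow> s \<in> R \<Longrightarrow> sup r s \<in> R"
    and "length rs = n" "set rs \<subseteq> R"
  shows "(\<lambda>i. f (map (\<lambda>r. r i) rs)) \<in> R"
proof -
  let ?P = "{(n, f) \<in> all_operations. \<forall>rs. length rs = n \<longrightarrow> set rs \<subseteq> R \<longrightarrow>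
           (\<lambda>i. f (map (\<lambda>r. r i) rs)) \<in> R}"
  have two: "length rs = 2 \<longleftrightarrow> (\<exists>r s. rs = [r, s])" for rs :: "('i \<Rightarrow> 'a) list"
    by (auto simp: numeral_2_eq_2 length_Suc_conv)
  have "{meet_op, join_op} \<subseteq> ?P"
    using lattice_ops_in_all_operations assms(2,3)
    by (auto simp: meet_op_def join_op_def two tuples_def inf_fun_def sup_fun_def)
  then have "lattice_clone \<subseteq> ?P"
    using is_clone_polymorphisms[of R] unfolding clone_generated_def by blast
  then show ?thesis
    using assms unfolding nary_def by blast
qed

text \<open>The meet and the join of two comparable rows are among these rows, so every chain in a
  power of the lattice is a sublattice.\<close>

lemma lattice_clone_preserves_chain:
  fixes R :: "('i \<Rightarrow> 'a::lattice) set"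
  assumes f: "f \<in> nary lattice_clone n"
    and chain: "\<And>r s. r \<in> R \<Longrightarrow> s \<in> R \<Longrightarrow> r \<le> s \<or> s \<le> r"
    and "length rs = n" "set rs \<subseteq> R"
  shows "(\<lambda>i. f (map (\<lambda>r. r i) rs)) \<in> R"
proof (rule lattice_clone_preserves[OF f])
  show "inf r s \<in> R" "sup r s \<in> R" if "r \<in> R" "s \<in> R" for r s
    using chain[OF that] that by (auto simp: inf_absorb1 inf_absorb2 sup_absorb1 sup_absorb2)
qed (use assms in auto)

section \<open>The centralizer as the set of lattice homomorphisms\<close>

lemma centralizer_memberI:
  fixes F :: "'a::lattice list \<Rightarrow> 'a"
  assumes m: "m > 0" and ext: "F \<in> extensional (tuples m)"
    and inf: "\<And>u v. F (map (\<lambda>i. inf (u i) (v i)) [0..<m]) = inf (F (map u [0..<m])) (F (map v [0..<m]))"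
    and sup: "\<And>u v. F (map (\<lambda>i. sup (u i) (v i)) [0..<m]) = sup (F (map u [0..<m])) (F (map v [0..<m]))"
  shows "(m, F) \<in> centralizer lattice_clone"
proof -
  have "F (map (\<lambda>i. g (map (a i) [0..<n])) [0..<m]) =
        g (map (\<lambda>j. F (map (\<lambda>i. a i j) [0..<m])) [0..<n])"
    if "(n, g) \<in> lattice_clone" for n g and a :: "nat \<Rightarrow> nat \<Rightarrow> 'a"
  proof -
    \<comment> \<open>Commuting with \<open>F\<close> means preserving the graph of \<open>F\<close>, whose last coordinate has index \<open>m\<close>.\<close>
    let ?R = "{r :: nat \<Rightarrow> 'a. r m = F (map r [0..<m])}"
    \<comment> \<open>Column \<open>j\<close> of the matrix, extended by its image under
      \<open>F\<close>, is a point of the graph.\<close>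
    let ?r = "\<lambda>j i. if i < m then a i j else F (map (\<lambda>i. a i j) [0..<m])"
    have r: "map (?r j) [0..<m] = map (\<lambda>i. a i j) [0..<m]" for j
      by simp
    have "(\<lambda>i. g (map (\<lambda>r. r i) (map ?r [0..<n]))) \<in> ?R"
    proof (rule lattice_clone_preserves)
      show "g \<in> nary lattice_clone n" using that by (simp add: nary_def)
      show "set (map ?r [0..<n]) \<subseteq> ?R"
        using r by (auto simp del: map_eq_conv)
    qed (auto simp: inf[symmetric] sup[symmetric] intro!: arg_cong[of _ _ F])
    then have "g (map (\<lambda>j. ?r j m) [0..<n]) = F (map (\<lambda>i. g (map (\<lambda>j. ?r j i) [0..<n])) [0..<m])"
      by (simp add: o_def)
    moreover have "map (\<lambda>i. g (map (\<lambda>j. ?r j i) [0..<n])) [0..<m] = map (\<lambda>i. g (map (a i) [0..<n])) [0..<m]"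
      by simp
    ultimately show ?thesis by simp
  qed
  then show ?thesis
    using m ext by (auto simp: centralizer_def all_operations_def commutes_def)
qed

text \<open>This is commutation with \<open>meet_op\<close>, read as a homomorphism law. With
  \<open>u\<close> and \<open>v\<close> arbitrary functions of the list entries, it covers
  coordinates of tuples as well as witnesses chosen for them.\<close>

lemma centralizer_inf:
  fixes F :: "'a::lattice list \<Rightarrow> 'a"
  assumes "F \<in> nary (centralizer lattice_clone) (length ts)"
  shows "F (map (\<lambda>t. inf (u t) (v t)) ts) = inf (F (map u ts)) (F (map v ts))"
proof -
  let ?m = "length ts"
  have "commutes (?m, F) meet_op"
    using assms meet_op_in_clone by (auto simp: centralizer_def nary_def)
  then have *: "F (map (\<lambda>i. inf (a i 0) (a i 1)) [0..<?m]) =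
       inf (F (map (\<lambda>i. a i 0) [0..<?m])) (F (map (\<lambda>i. a i 1) [0..<?m]))"
    for a :: "nat \<Rightarrow> nat \<Rightarrow> 'a"
    by (auto simp: commutes_def meet_op_def tuples_def upt_rec)
  have m: "map w ts = map (\<lambda>i. w (ts ! i)) [0..<?m]" for w :: "'b \<Rightarrow> 'a"
    using arg_cong[OF map_nth[of ts], of "map w"] by (simp add: o_def)
  show ?thesis
    unfolding m using *[of "\<lambda>i j. if j = 0 then u (ts ! i) else v (ts ! i)"] by simp
qed

lemma centralizer_sup:
  fixes F :: "'a::lattice list \<Rightarrow> 'a"
  assumes "F \<in> nary (centralizer lattice_clone) (length ts)"
  shows "F (map (\<lambda>t. sup (u t) (v t)) ts) = sup (F (map u ts)) (F (map v ts))"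
proof -
  let ?m = "length ts"
  have "commutes (?m, F) join_op"
    using assms join_op_in_clone by (auto simp: centralizer_def nary_def)
  then have *: "F (map (\<lambda>i. sup (a i 0) (a i 1)) [0..<?m]) =
       sup (F (map (\<lambda>i. a i 0) [0..<?m])) (F (map (\<lambda>i. a i 1) [0..<?m]))"
    for a :: "nat \<Rightarrow> nat \<Rightarrow> 'a"
    by (auto simp: commutes_def join_op_def tuples_def upt_rec)
  have m: "map w ts = map (\<lambda>i. w (ts ! i)) [0..<?m]" for w :: "'b \<Rightarrow> 'a"
    using arg_cong[OF map_nth[of ts], of "map w"] by (simp add: o_def)
  show ?thesis
    unfolding m using *[of "\<lambda>i j. if j = 0 then u (ts ! i) else v (ts ! i)"] by simp
qed

section \<open>Solution sets and closed sets\<close>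

text \<open>Any system defining \<open>T\<close> consists of equations valid on \<open>T\<close>, so
  a point satisfying all valid equations solves it.\<close>

lemma SDC_memberI:
  assumes "SDC C" "n > 0" "T \<subseteq> tuples n" "T \<noteq> {}" "closed_under n T (centralizer C)"
    and a: "a \<in> tuples n"
    and eq: "\<And>f g. f \<in> nary C n \<Longrightarrow> g \<in> nary C n \<Longrightarrow> (\<And>t. t \<in> T \<Longrightarrow> f t = g t) \<Longrightarrow> f a = g a"
  shows "a \<in> T"
proof -
  obtain E where E: "equation_system C n E" "T = Sol n E"
    using assms(1-5) unfolding SDC_def by metis
  have "f a = g a" if "(f, g) \<in> E" for f g
  proof (rule eq)
    show "f \<in> nary C n" "g \<in> nary C n"
      using E(1) that unfolding equation_system_def by blast+
    show "f t = g t" if "t \<in> T" for t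
      using that \<open>(f, g) \<in> E\<close> unfolding E(2) Sol_def by blast
  qed
  then show ?thesis
    using a unfolding E(2) Sol_def by blast
qed

text \<open>Each side \<open>f\<close> of an equation commutes with \<open>F\<close>, so its value
  at the new tuple is \<open>F\<close> of its values at \<open>ts\<close>, where both sides
  agree.\<close>

lemma closed_under_Sol:
  assumes "equation_system C n E"
  shows "closed_under n (Sol n E) (centralizer C)"
  unfolding closed_under_def
proof (intro allI impI)
  fix m ts F
  assume m: "length ts = m" and ts: "set ts \<subseteq> Sol n E" and F: "F \<in> nary (centralizer C) m"
  have *: "f (map (\<lambda>j. F (map (\<lambda>t. t ! j) ts)) [0..<n]) = F (map f ts)" if "f \<in> nary C n" for f
  proof -
    have nth: "map (\<lambda>i. w (ts ! i)) [0..<m] = map w ts" for w :: "'a list \<Rightarrow> 'a"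
      using arg_cong[OF map_nth[of ts], of "map w"] m by (simp add: o_def)
    have "F (map (\<lambda>i. f (map (\<lambda>j. ts ! i ! j) [0..<n])) [0..<m]) =
          f (map (\<lambda>j. F (map (\<lambda>i. ts ! i ! j) [0..<m])) [0..<n])"
      using F that unfolding nary_def centralizer_def commutes_def by auto
    then have "F (map (\<lambda>t. f (map (\<lambda>j. t ! j) [0..<n])) ts) = f (map (\<lambda>j. F (map (\<lambda>t. t ! j) ts)) [0..<n])"
      using nth[of "\<lambda>t. f (map (\<lambda>j. t ! j) [0..<n])"] nth[of "\<lambda>t. t ! _"] by simp
    moreover have "map (\<lambda>t. f (map (\<lambda>j. t ! j) [0..<n])) ts = map f ts"
    proof (rule map_cong[OF refl])
      fix t assume "t \<in> set ts"
      then have "length t = n" using ts by (auto simp: Sol_def tuples_def)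
      then show "f (map (\<lambda>j. t ! j) [0..<n]) = f t" using map_nth[of t] by simp
    qed
    ultimately show ?thesis by simp
  qed
  show "map (\<lambda>i. F (map (\<lambda>t. t ! i) ts)) [0..<n] \<in> Sol n E"
  proof -
    have "f (map (\<lambda>j. F (map (\<lambda>t. t ! j) ts)) [0..<n]) = g (map (\<lambda>j. F (map (\<lambda>t. t ! j) ts)) [0..<n])"
      if "(f, g) \<in> E" for f g
    proof -
      have "f \<in> nary C n" "g \<in> nary C n"
        using that assms by (auto simp: equation_system_def)
      moreover have "map f ts = map g ts"
        using ts that by (auto simp: Sol_def)
      ultimately show ?thesis by (simp add: * del: map_eq_conv)
    qed
    then show ?thesis by (auto simp: Sol_def tuples_def)
  qed
qed

section \<open>From (SDC) to a Boolean lattice\<close>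

lemma lattice_SDC_disjointness:
  fixes x y a b bot top :: "'a::lattice"
  assumes SDC: "SDC (lattice_clone :: 'a operation set)"
    and bot: "\<And>z. bot \<le> z" and top: "\<And>z. z \<le> top"
    and "inf y a = x" "inf y b = x" "y \<le> sup a b"
  shows "y = x"
proof (rule ccontr)
  assume "y \<noteq> x"
  have "x \<le> y" using assms by auto
  \<comment> \<open>The inequality \<open>y \<le> sup a b\<close> is written as an equation, so that
    homomorphisms preserve all of \<open>?P\<close>.\<close>
  let ?P = "\<lambda>x y a b :: 'a. inf y a = x \<and> inf y b = x \<and> inf y (sup a b) = y"
  let ?T = "{[x, y] | x y. \<exists>a b. ?P x y a b}"
  have "?P x y a b" using assms(4-6) by (simp add: inf_absorb1)
  then have "[x, y] \<in> ?T" by blast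
  have "[bot, top] \<in> ?T"
  proof (rule SDC_memberI[OF SDC])
    show "closed_under 2 ?T (centralizer lattice_clone)"
      unfolding closed_under_def
    proof (intro allI impI)
      fix m ts F
      assume m: "length ts = m" and ts: "set ts \<subseteq> ?T"
        and F: "F \<in> nary (centralizer (lattice_clone :: 'a operation set)) m"
      have "\<forall>t\<in>set ts. \<exists>a b. ?P (t ! 0) (t ! 1) a b" using ts by fastforce
      then obtain A B where AB: "\<And>t. t \<in> set ts \<Longrightarrow> ?P (t ! 0) (t ! 1) (A t) (B t)"
        by metis
      note hom = centralizer_inf[OF F[folded m], symmetric] centralizer_sup[OF F[folded m], symmetric]
      have "?P (F (map (\<lambda>t. t ! 0) ts)) (F (map (\<lambda>t. t ! 1) ts)) (F (map A ts)) (F (map B ts))"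
        unfolding hom using AB by (auto intro!: arg_cong[of _ _ F])
      then show "map (\<lambda>i. F (map (\<lambda>t. t ! i) ts)) [0..<2] \<in> ?T"
        by (auto simp: upt_rec)
    qed
    fix f g assume f: "f \<in> nary lattice_clone 2" and g: "g \<in> nary (lattice_clone :: 'a operation set) 2"
      and eq: "\<And>t. t \<in> ?T \<Longrightarrow> f t = g t"
    \<comment> \<open>Index \<open>True\<close> carries the pair \<open>x, y\<close> and
      \<open>False\<close> the pair \<open>bot, top\<close>. The two rows form a chain, so a binary
      term picks the same position in both pairs.\<close>
    let ?r = "\<lambda>b. if b then x else bot" and ?s = "\<lambda>b. if b then y else top"
    have rs: "?r \<le> ?s" using bot \<open>x \<le> y\<close> by (simp add: le_fun_def)
    have mem: "(\<lambda>i. h (map (\<lambda>r. r i) [?r, ?s])) \<in> {?r, ?s}" if "h \<in> nary lattice_clone 2" for h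
      using rs by (intro lattice_clone_preserves_chain[OF that]) auto
    have "(h [x, y], h [bot, top]) \<in> {(x, bot), (y, top)}" if h: "h \<in> nary lattice_clone 2" for h
    proof -
      obtain k where k: "k \<in> {?r, ?s}" "(\<lambda>i. h (map (\<lambda>r. r i) [?r, ?s])) = k"
        using mem[OF h] by blast
      have "h (map (\<lambda>r. r i) [?r, ?s]) = k i" for i
        using k(2) by (rule fun_cong)
      from this[of True] this[of False] k(1) show ?thesis by auto
    qed
    from this[OF f] this[OF g] show "f [bot, top] = g [bot, top]"
      using eq[OF \<open>[x, y] \<in> ?T\<close>] \<open>y \<noteq> x\<close> by auto
  qed (use \<open>[x, y] \<in> ?T\<close> in \<open>auto simp: tuples_def\<close>)
  \<comment> \<open>Meeting \<open>top\<close> in \<open>bot\<close> forces \<open>c\<close> and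
    \<open>d\<close> to be \<open>bot\<close>, and then \<open>top\<close> lies below their join
    \<open>bot\<close>.\<close>
  then obtain c d where "?P bot top c d" by auto
  then have "bot = top" using top by (auto simp: inf_absorb2)
  then show False using \<open>y \<noteq> x\<close> bot top by (metis antisym)
qed

lemma lattice_SDC_section_complement:
  fixes w v bot :: "'a::lattice"
  assumes SDC: "SDC (lattice_clone :: 'a operation set)"
    and bot: "\<And>z. bot \<le> z" and "w \<le> v"
  shows "\<exists>u. inf u w = bot \<and> sup u w = v"
\<comment> \<open>If \<open>v = bot\<close>, then \<open>w = bot\<close> is its own complement.
  Otherwise \<open>bot\<close> and \<open>v\<close> differ, so the values of a term at
  \<open>[bot, bot, v]\<close> and \<open>[bot, v, v]\<close> determine its value at
  \<open>[bot, w, v]\<close>.\<close>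
proof (cases "v = bot")
  case True
  then show ?thesis using assms by (metis antisym inf_idem sup_idem)
next
  case False
  let ?P = "\<lambda>x y z u :: 'a. inf u y = x \<and> sup u y = z"
  let ?T = "{[x, y, z] | x y z. \<exists>u. ?P x y z u}"
  have T: "[bot, bot, v] \<in> ?T" "[bot, v, v] \<in> ?T"
    using bot by (auto simp: inf_absorb1 inf_absorb2 sup_absorb1 sup_absorb2 intro: exI[of _ v] exI[of _ bot])
  have "[bot, w, v] \<in> ?T"
  proof (rule SDC_memberI[OF SDC])
    show "closed_under 3 ?T (centralizer lattice_clone)"
      unfolding closed_under_def
    proof (intro allI impI)
      fix m ts F
      assume m: "length ts = m" and ts: "set ts \<subseteq> ?T"
        and F: "F \<in> nary (centralizer (lattice_clone :: 'a operation set)) m"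
      have "\<forall>t\<in>set ts. \<exists>u. ?P (t ! 0) (t ! 1) (t ! 2) u" using ts by fastforce
      then obtain U where U: "\<And>t. t \<in> set ts \<Longrightarrow> ?P (t ! 0) (t ! 1) (t ! 2) (U t)"
        by metis
      note hom = centralizer_inf[OF F[folded m], symmetric] centralizer_sup[OF F[folded m], symmetric]
      have "?P (F (map (\<lambda>t. t ! 0) ts)) (F (map (\<lambda>t. t ! 1) ts)) (F (map (\<lambda>t. t ! 2) ts)) (F (map U ts))"
        unfolding hom using U by (auto intro!: arg_cong[of _ _ F])
      then show "map (\<lambda>i. F (map (\<lambda>t. t ! i) ts)) [0..<3] \<in> ?T"
        by (auto simp: upt_rec numeral_2_eq_2)
    qed
    fix f g assume f: "f \<in> nary lattice_clone 3" and g: "g \<in> nary (lattice_clone :: 'a operation set) 3"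
      and eq: "\<And>t. t \<in> ?T \<Longrightarrow> f t = g t"
    \<comment> \<open>The chain \<open>bot \<le> w \<le> v\<close> is a subdirect product of two copies of \<open>{bot, v}\<close>.\<close>
    let ?r = "\<lambda>i::nat. bot" and ?t = "\<lambda>i::nat. v"
    let ?s = "\<lambda>i::nat. if i = 0 then w else if i = 1 then bot else v"
    have rst: "?r \<le> ?s" "?s \<le> ?t" "?r \<le> ?t"
      using bot \<open>w \<le> v\<close> by (simp_all add: le_fun_def)
    have mem: "(\<lambda>i. h (map (\<lambda>r. r i) [?r, ?s, ?t])) \<in> {?r, ?s, ?t}" if "h \<in> nary lattice_clone 3" for h
      using rst by (intro lattice_clone_preserves_chain[OF that]) auto
    have "(h [bot, w, v], h [bot, bot, v], h [bot, v, v]) \<in> {(bot, bot, bot), (w, bot, v), (v, v, v)}"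
      if h: "h \<in> nary lattice_clone 3" for h
    proof -
      obtain k where k: "k \<in> {?r, ?s, ?t}" "(\<lambda>i. h (map (\<lambda>r. r i) [?r, ?s, ?t])) = k"
        using mem[OF h] by blast
      have "h (map (\<lambda>r. r i) [?r, ?s, ?t]) = k i" for i
        using k(2) by (rule fun_cong)
      from this[of 0] this[of 1] this[of 2] k(1) show ?thesis by auto
    qed
    from this[OF f] this[OF g] show "f [bot, w, v] = g [bot, w, v]"
      using eq[OF T(1)] eq[OF T(2)] False by auto
  qed (use T in \<open>auto simp: tuples_def\<close>)
  then show ?thesis by auto
qed

lemma boolean_lattice_if_lattice_SDC:
  assumes "lattice_SDC TYPE('a::{finite,lattice})"
  shows "boolean_lattice TYPE('a)"
proof -
  have SDC: "SDC (lattice_clone :: 'a operation set)"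
    using assms by (simp add: lattice_SDC_def)
  define bot top :: 'a where "bot = Inf_fin UNIV" and "top = Sup_fin UNIV"
  have bot: "bot \<le> z" and top: "z \<le> top" for z :: 'a
    unfolding bot_def top_def by (auto intro: Inf_fin.coboundedI Sup_fin.coboundedI)
  have distr: "inf (sup x y) z = sup (inf x z) (inf y z)" for x y z :: 'a
  proof -
    define v w where "v = inf (sup x y) z" and "w = sup (inf x z) (inf y z)"
    have "w \<le> v" by (auto simp: v_def w_def intro: le_infI1 le_infI2)
    obtain u where u: "inf u w = bot" "sup u w = v"
      using lattice_SDC_section_complement[OF SDC bot \<open>w \<le> v\<close>] by blast
    have uv: "u \<le> v" using u(2) by auto
    \<comment> \<open>Used for \<open>c\<close> equal to \<open>x\<close> and to \<open>y\<close>.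
      As \<open>u \<le> v \<le> z\<close>, the element \<open>inf u c\<close> is below
      \<open>inf c z\<close>, hence below \<open>w\<close>, which meets \<open>u\<close> in
      \<open>bot\<close>.\<close>
    have "inf u c = bot" if "inf c z \<le> w" for c
    proof -
      have "inf u c \<le> w"
        using uv that unfolding v_def by (meson inf.cobounded1 inf.cobounded2 le_inf_iff order_trans)
      then have "inf u c \<le> inf u w" by simp
      then show ?thesis using u(1) bot by (metis antisym)
    qed
    then have "inf u x = bot" "inf u y = bot" by (auto simp: w_def)
    moreover have "u \<le> sup x y" using uv by (simp add: v_def)
    ultimately have "u = bot"
      by (rule lattice_SDC_disjointness[OF SDC bot top])
    then have "v = w" using u(2) bot by (simp add: sup_absorb2)
    then show ?thesis by (simp add: v_def w_def)
  qed
  have "class.distrib_lattice (inf :: 'a \<Rightarrow> 'a \<Rightarrow> 'a) (\<le>) (<) sup"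
  proof
    \<comment> \<open>The class axiom is the dual law; two expansions by \<open>distr\<close> and
      absorption give it.\<close>
    show "sup x (inf y z) = inf (sup x y) (sup x z)" for x y z :: 'a
    proof -
      have "inf (sup x y) (sup x z) = sup x (inf (sup x z) y)"
        by (simp add: distr inf_commute[of y])
      also have "\<dots> = sup (sup x (inf x y)) (inf z y)"
        by (simp only: distr sup_assoc)
      also have "\<dots> = sup x (inf y z)"
        by (simp add: inf_commute)
      finally show ?thesis by simp
    qed
  qed
  moreover have "class.bounded_lattice (inf :: 'a \<Rightarrow> 'a \<Rightarrow> 'a) (\<le>) (<) sup bot top"
    by standard (auto simp: bot top)
  moreover have "\<exists>y. inf x y = bot \<and> sup x y = top" for x
    using lattice_SDC_section_complement[OF SDC bot top, of x] by (metis inf_commute sup_commute)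
  ultimately show ?thesis
    unfolding boolean_lattice_def by blast
qed

section \<open>Atoms of a finite Boolean lattice\<close>

text \<open>Together the three properties identify the lattice with the power set of
  \<open>At\<close>, in the form needed to build elements and homomorphisms atom by atom.\<close>

lemma boolean_lattice_atoms:
  assumes "boolean_lattice TYPE('a::{finite,lattice})"
  obtains At :: "'a::{finite,lattice} set" where
    "\<And>p x y. p \<in> At \<Longrightarrow> p \<le> sup x y \<longleftrightarrow> p \<le> x \<or> p \<le> y"
    "\<And>x y. \<forall>p\<in>At. p \<le> x \<longrightarrow> p \<le> y \<Longrightarrow> x \<le> y"
    "\<And>P. P \<subseteq> At \<Longrightarrow> \<exists>x. \<forall>p\<in>At. p \<le> x \<longleftrightarrow> p \<in> P"
proof -
  obtain zero one :: 'a where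
    dl: "class.distrib_lattice (inf :: 'a \<Rightarrow> 'a \<Rightarrow> 'a) (\<le>) (<) sup" and
    bl: "class.bounded_lattice (inf :: 'a \<Rightarrow> 'a \<Rightarrow> 'a) (\<le>) (<) sup zero one" and
    compl: "\<And>x. \<exists>y. inf x y = zero \<and> sup x y = one"
    using assms unfolding boolean_lattice_def by blast
  interpret D: distrib_lattice "inf :: 'a \<Rightarrow> 'a \<Rightarrow> 'a" "(\<le>)" "(<)" sup by (rule dl)
  interpret B: bounded_lattice "inf :: 'a \<Rightarrow> 'a \<Rightarrow> 'a" "(\<le>)" "(<)" sup zero one by (rule bl)
  define At where "At = {p. p \<noteq> zero \<and> (\<forall>x\<le>p. x = zero \<or> x = p)}"
  have prime: "p \<le> sup x y \<longleftrightarrow> p \<le> x \<or> p \<le> y" if "p \<in> At" for p x y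
  proof
    assume "p \<le> sup x y"
    \<comment> \<open>Both parts are \<open>zero\<close> or \<open>p\<close>, and they cannot both
      be \<open>zero\<close> because \<open>p\<close> is not.\<close>
    then have "p = sup (inf p x) (inf p y)"
      by (metis D.inf_sup_distrib1 inf_absorb1)
    moreover have "c = zero \<or> c = p" if "c \<le> p" for c
      using \<open>p \<in> At\<close> that by (simp add: At_def)
    from this[of "inf p x"] this[of "inf p y"]
    have "(inf p x = zero \<or> inf p x = p) \<and> (inf p y = zero \<or> inf p y = p)" by simp
    ultimately have "inf p x = p \<or> inf p y = p"
      using that by (metis sup.idem)
    then show "p \<le> x \<or> p \<le> y" by (metis inf.cobounded2)
  qed (auto intro: le_supI1 le_supI2)
  have below: "\<exists>p\<in>At. p \<le> x" if "x \<noteq> zero" for x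
  proof -
    let ?S = "{c. c \<noteq> zero \<and> c \<le> x}"
    have "\<exists>p\<in>?S. \<forall>c\<in>?S. c \<le> p \<longrightarrow> p = c"
    proof (rule finite_has_minimal)
      show "?S \<noteq> {}" using that by blast
    qed simp
    then obtain p where p: "p \<noteq> zero" "p \<le> x" and min: "\<forall>c\<in>?S. c \<le> p \<longrightarrow> p = c" by blast
    have "c = zero \<or> c = p" if "c \<le> p" for c
      using min that order_trans[OF that p(2)] by blast
    with p(1) have "p \<in> At" by (simp add: At_def)
    then show ?thesis using p by blast
  qed
  have ext: "x \<le> y" if "\<forall>p\<in>At. p \<le> x \<longrightarrow> p \<le> y" for x y
  proof -
    \<comment> \<open>An atom below \<open>x\<close> and the complement \<open>z\<close> of
      \<open>y\<close> would lie below \<open>inf y z = zero\<close>. Hence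
      \<open>inf x z = zero\<close>, and expanding \<open>inf x (sup y z)\<close> leaves
      \<open>inf x y\<close>.\<close>
    obtain z where z: "inf y z = zero" "sup y z = one" using compl by blast
    have "inf x z = zero"
    proof (rule ccontr)
      assume "inf x z \<noteq> zero"
      then obtain p where p: "p \<in> At" "p \<le> x" "p \<le> z" using below by fastforce
      then have "p \<le> inf y z" using that by simp
      then show False using p(1) z(1) B.bot.extremum_unique by (simp add: At_def)
    qed
    then have "x = inf x y"
      using D.inf_sup_distrib1[of x y z] z(2) by simp
    then show ?thesis by (simp add: inf.absorb_iff1)
  qed
  have ex: "\<exists>x. \<forall>p\<in>At. p \<le> x \<longleftrightarrow> p \<in> P" if "P \<subseteq> At" for P
    using finite[of P] that
  proof induction
    case empty
    have "\<not> p \<le> zero" if "p \<in> At" for p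
      using that B.bot.extremum_unique by (auto simp: At_def)
    then show ?case by blast
  next
    case (insert q P)
    then obtain x where x: "\<forall>p\<in>At. p \<le> x \<longleftrightarrow> p \<in> P" by blast
    \<comment> \<open>Comparable atoms are equal, so by primality joining \<open>q\<close> adds only
      \<open>q\<close> to the atoms below.\<close>
    have "p \<le> q \<longleftrightarrow> p = q" if "p \<in> At" for p
      using that insert.prems by (auto simp: At_def)
    then have "\<forall>p\<in>At. p \<le> sup q x \<longleftrightarrow> p \<in> insert q P"
      using x prime by simp
    then show ?case by blast
  qed
  show ?thesis using that[OF prime ext ex] by blast
qed

section \<open>Meets and joins of variables as term operations\<close>

lemma is_clone_composition:
  assumes "is_clone C" "f \<in> nary C m" "length gs = m" "set gs \<subseteq> nary C n"
  shows "composition n f gs \<in> nary C n"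
  using assms unfolding is_clone_def nary_def by blast

lemma lattice_clone_inf:
  assumes "f \<in> nary lattice_clone n" "g \<in> nary lattice_clone n"
  shows "(\<lambda>xs\<in>tuples n. inf (f xs) (g xs)) \<in> nary (lattice_clone :: 'a::lattice operation set) n"
proof -
  have "snd meet_op \<in> nary (lattice_clone :: 'a operation set) 2"
    using meet_op_in_clone by (simp add: nary_def meet_op_def)
  then have "composition n (snd meet_op) [f, g] \<in> nary (lattice_clone :: 'a operation set) n"
    using assms by (intro is_clone_composition[OF is_clone_lattice_clone, of _ 2]) auto
  then show ?thesis
    by (simp add: composition_def meet_op_def tuples_def)
qed

lemma lattice_clone_sup:
  assumes "f \<in> nary lattice_clone n" "g \<in> nary lattice_clone n"
  shows "(\<lambda>xs\<in>tuples n. sup (f xs) (g xs)) \<in> nary (lattice_clone :: 'a::lattice operation set) n"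
proof -
  have "snd join_op \<in> nary (lattice_clone :: 'a operation set) 2"
    using join_op_in_clone by (simp add: nary_def join_op_def)
  then have "composition n (snd join_op) [f, g] \<in> nary (lattice_clone :: 'a operation set) n"
    using assms by (intro is_clone_composition[OF is_clone_lattice_clone, of _ 2]) auto
  then show ?thesis
    by (simp add: composition_def join_op_def tuples_def)
qed

lemma lattice_clone_nth:
  assumes "i < n"
  shows "(\<lambda>xs\<in>tuples n. xs ! i) \<in> nary (lattice_clone :: 'a::lattice operation set) n"
  using is_clone_lattice_clone assms unfolding is_clone_def nary_def projection_def by blast

text \<open>The term is built by adding one variable at a time, starting from a single one because
  an empty meet is not a lattice term.\<close>

lemma lattice_clone_Inf_fin:
  assumes "finite I" "I \<noteq> {}" "I \<subseteq> {..<n}"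
  shows "(\<lambda>xs\<in>tuples n. Inf_fin ((!) xs ` I)) \<in> nary (lattice_clone :: 'a::lattice operation set) n"
  using assms
proof (induction rule: finite_ne_induct)
  case (singleton i)
  then show ?case using lattice_clone_nth[of i n] by (simp add: restrict_def)
next
  case (insert i I)
  then have "(\<lambda>xs\<in>tuples n. inf ((\<lambda>xs\<in>tuples n. xs ! i) xs) ((\<lambda>xs\<in>tuples n. Inf_fin ((!) xs ` I)) xs))
      \<in> nary (lattice_clone :: 'a operation set) n"
    by (intro lattice_clone_inf lattice_clone_nth) auto
  then show ?case using insert.hyps by (simp add: restrict_def cong: if_cong)
qed

lemma lattice_clone_Sup_fin:
  assumes "finite I" "I \<noteq> {}" "I \<subseteq> {..<n}"
  shows "(\<lambda>xs\<in>tuples n. Sup_fin ((!) xs ` I)) \<in> nary (lattice_clone :: 'a::lattice operation set) n"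
  using assms
proof (induction rule: finite_ne_induct)
  case (singleton i)
  then show ?case using lattice_clone_nth[of i n] by (simp add: restrict_def)
next
  case (insert i I)
  then have "(\<lambda>xs\<in>tuples n. sup ((\<lambda>xs\<in>tuples n. xs ! i) xs) ((\<lambda>xs\<in>tuples n. Sup_fin ((!) xs ` I)) xs))
      \<in> nary (lattice_clone :: 'a operation set) n"
    by (intro lattice_clone_sup lattice_clone_nth) auto
  then show ?case using insert.hyps by (simp add: restrict_def cong: if_cong)
qed

lemma prime_le_Sup_fin_iff:
  fixes p :: "'a::lattice"
  assumes prime: "\<And>x y. p \<le> sup x y \<longleftrightarrow> p \<le> x \<or> p \<le> y"
    and "finite A" "A \<noteq> {}"
  shows "p \<le> Sup_fin A \<longleftrightarrow> (\<exists>a\<in>A. p \<le> a)"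
  using assms(2,3) by (induction rule: finite_ne_induct) (simp_all add: prime)

section \<open>From a Boolean lattice to (SDC)\<close>

lemma boolean_lattice_separation:
  fixes T :: "'a::{finite,lattice} list set"
  assumes "boolean_lattice TYPE('a)"
    and T: "T \<subseteq> tuples n" "T \<noteq> {}" "closed_under n T (centralizer lattice_clone)"
    and a: "a \<in> tuples n" "a \<notin> T"
  shows "\<exists>f\<in>nary lattice_clone n. \<exists>g\<in>nary lattice_clone n. (\<forall>t\<in>T. f t = g t) \<and> f a \<noteq> g a"
proof -
  obtain At :: "'a set" where
    prime: "\<And>p x y. p \<in> At \<Longrightarrow> p \<le> sup x y \<longleftrightarrow> p \<le> x \<or> p \<le> y" and
    ext: "\<And>x y. \<forall>p\<in>At. p \<le> x \<longrightarrow> p \<le> y \<Longrightarrow> x \<le> y" and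
    ex: "\<And>P. P \<subseteq> At \<Longrightarrow> \<exists>x. \<forall>p\<in>At. p \<le> x \<longleftrightarrow> p \<in> P"
    by (rule boolean_lattice_atoms[OF assms(1)]) blast
  have eqI: "x = y" if "\<And>p. p \<in> At \<Longrightarrow> p \<le> x \<longleftrightarrow> p \<le> y" for x y
    using that by (intro antisym ext) auto
  \<comment> \<open>Homomorphisms to the two-element lattice. Only meet and join are to be
    preserved, so both constant maps belong to \<open>H\<close>.\<close>
  define H where "H = {\<phi> :: 'a \<Rightarrow> bool. \<forall>x y. \<phi> (inf x y) = (\<phi> x \<and> \<phi> y) \<and> \<phi> (sup x y) = (\<phi> x \<or> \<phi> y)}"
  have "finite T"
    using T(1) finite_lists_length_eq[of "UNIV :: 'a set" n]
    by (auto simp: tuples_def intro: finite_subset)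
  then obtain ts where ts: "set ts = T" using finite_list by blast
  define m where "m = length ts"
  have "m > 0" using ts T(2) by (auto simp: m_def)
  have "\<exists>p\<in>At. \<forall>t\<in>T. \<forall>\<phi>\<in>H. \<exists>k<n. \<phi> (t ! k) \<noteq> (p \<le> a ! k)"
  proof (rule ccontr)
    \<comment> \<open>Otherwise the homomorphism whose \<open>p\<close>-component reads \<open>\<Phi> p\<close> off the argument number \<open>I p\<close>
      maps \<open>ts\<close> to \<open>a\<close>.\<close>
    assume "\<not> ?thesis"
    then have "\<forall>p\<in>At. \<exists>i \<phi>. i < m \<and> \<phi> \<in> H \<and> (\<forall>k<n. \<phi> (ts ! i ! k) = (p \<le> a ! k))"
      unfolding ts[symmetric] m_def by (auto simp: Bex_def in_set_conv_nth) blast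
    then obtain I \<Phi> where I: "\<And>p. p \<in> At \<Longrightarrow> I p < m" and \<Phi>: "\<And>p. p \<in> At \<Longrightarrow> \<Phi> p \<in> H"
      and eq: "\<And>p k. p \<in> At \<Longrightarrow> k < n \<Longrightarrow> \<Phi> p (ts ! I p ! k) = (p \<le> a ! k)"
      by metis
    have "\<exists>x. \<forall>p\<in>At. p \<le> x \<longleftrightarrow> \<Phi> p (xs ! I p)" for xs
      using ex[of "{p \<in> At. \<Phi> p (xs ! I p)}"] by auto
    then obtain G where G: "\<And>xs p. p \<in> At \<Longrightarrow> p \<le> G xs \<longleftrightarrow> \<Phi> p (xs ! I p)"
      by metis
    define F where "F = restrict G (tuples m)"
    have F: "p \<le> F xs \<longleftrightarrow> \<Phi> p (xs ! I p)" if "p \<in> At" "length xs = m" for p xs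
      using that G by (simp add: F_def tuples_def)
    have "(m, F) \<in> centralizer lattice_clone"
    proof (rule centralizer_memberI[OF \<open>m > 0\<close>])
      show "F \<in> extensional (tuples m)" by (simp add: F_def)
      show "F (map (\<lambda>i. inf (u i) (v i)) [0..<m]) = inf (F (map u [0..<m])) (F (map v [0..<m]))" for u v
        using I \<Phi> by (intro eqI) (simp add: F H_def)
      show "F (map (\<lambda>i. sup (u i) (v i)) [0..<m]) = sup (F (map u [0..<m])) (F (map v [0..<m]))" for u v
        using I \<Phi> by (intro eqI) (simp add: F H_def prime)
    qed
    then have "map (\<lambda>k. F (map (\<lambda>t. t ! k) ts)) [0..<n] \<in> T"
      using T(3) ts unfolding closed_under_def nary_def m_def by blast
    moreover have "map (\<lambda>k. F (map (\<lambda>t. t ! k) ts)) [0..<n] = a"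
    proof (rule nth_equalityI)
      fix k assume "k < length (map (\<lambda>k. F (map (\<lambda>t. t ! k) ts)) [0..<n])"
      then have "k < n" by simp
      have "F (map (\<lambda>t. t ! k) ts) = a ! k"
      proof (rule eqI)
        fix p assume p: "p \<in> At"
        then show "p \<le> F (map (\<lambda>t. t ! k) ts) \<longleftrightarrow> p \<le> a ! k"
          using F[of p "map (\<lambda>t. t ! k) ts"] eq[OF p \<open>k < n\<close>] I[OF p] by (simp add: m_def)
      qed
      then show "map (\<lambda>k. F (map (\<lambda>t. t ! k) ts)) [0..<n] ! k = a ! k"
        using \<open>k < n\<close> by simp
    qed (use a in \<open>simp add: tuples_def\<close>)
    ultimately show False using a(2) by simp
  qed
  then obtain p where p: "p \<in> At" and sep: "\<And>t \<phi>. t \<in> T \<Longrightarrow> \<phi> \<in> H \<Longrightarrow> \<exists>k<n. \<phi> (t ! k) \<noteq> (p \<le> a ! k)"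
    by blast
  define I K where "I = {k. k < n \<and> p \<le> a ! k}" and "K = {k. k < n \<and> \<not> p \<le> a ! k}"
  have fin: "finite I" "finite K" "I \<subseteq> {..<n}" "K \<subseteq> {..<n}"
    by (auto simp: I_def K_def)
  obtain t where "t \<in> T" using T(2) by blast
  \<comment> \<open>The constant maps rule out that the truth values of \<open>p \<le> a ! k\<close>
    all agree, so neither the meet nor the join below is empty.\<close>
  have "(\<lambda>_. True) \<in> H" "(\<lambda>_. False) \<in> H" by (auto simp: H_def)
  then have ne: "I \<noteq> {}" "K \<noteq> {}"
    using sep[OF \<open>t \<in> T\<close>] unfolding I_def K_def by blast+
  let ?f = "\<lambda>xs :: 'a list\<in>tuples n. Inf_fin ((!) xs ` I)" and ?s = "\<lambda>xs :: 'a list\<in>tuples n. Sup_fin ((!) xs ` K)"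
  \<comment> \<open>Agreement of \<open>?f\<close> and \<open>?g\<close> at a tuple expresses
    \<open>?f \<le> ?s\<close> there.\<close>
  let ?g = "\<lambda>xs\<in>tuples n. inf (?f xs) (?s xs)"
  have f: "?f \<in> nary (lattice_clone :: 'a operation set) n"
    and s: "?s \<in> nary (lattice_clone :: 'a operation set) n"
    using lattice_clone_Inf_fin lattice_clone_Sup_fin fin ne by blast+
  have le_f: "q \<le> ?f x \<longleftrightarrow> (\<forall>i\<in>I. q \<le> x ! i)" if "x \<in> tuples n" for q x
    using that fin ne by (simp add: Inf_fin.bounded_iff)
  have le_s: "q \<le> ?s x \<longleftrightarrow> (\<exists>i\<in>K. q \<le> x ! i)" if "x \<in> tuples n" "q \<in> At" for q x
    using that fin ne by (simp add: prime_le_Sup_fin_iff[OF prime])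
  have "?f t = ?g t" if t: "t \<in> T" for t
  proof -
    have tn: "t \<in> tuples n" using t T(1) by blast
    have "?f t \<le> ?s t"
    proof (rule ext, intro ballI impI)
      fix q assume q: "q \<in> At" "q \<le> ?f t"
      show "q \<le> ?s t"
      proof (rule ccontr)
        assume "\<not> q \<le> ?s t"
        \<comment> \<open>An atom \<open>q\<close> violating the inequality has the same truth
          values on \<open>t\<close> as \<open>p\<close> has on \<open>a\<close>, and comparison
          with \<open>q\<close> is a homomorphism in \<open>H\<close>.\<close>
        then have "\<forall>k<n. q \<le> t ! k \<longleftrightarrow> p \<le> a ! k"
          using q le_f[OF tn] le_s[OF tn q(1)] by (auto simp: I_def K_def)
        moreover have "(\<le>) q \<in> H" using prime[OF q(1)] by (simp add: H_def)
        ultimately show False using sep[OF t] by blast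
      qed
    qed
    then show ?thesis using tn by (simp add: inf_absorb1)
  qed
  \<comment> \<open>By the choice of \<open>I\<close> and \<open>K\<close>, the atom
    \<open>p\<close> is below the meet at \<open>a\<close> and, being prime, not below the
    join.\<close>
  moreover have "?f a \<noteq> ?g a"
  proof
    assume "?f a = ?g a"
    then have "?f a \<le> ?s a" using a(1) by (metis (no_types, lifting) inf.cobounded2 restrict_apply')
    moreover have "p \<le> ?f a" using le_f[OF a(1)] by (simp add: I_def)
    ultimately have "p \<le> ?s a" by (rule order_trans[rotated])
    then show False using le_s[OF a(1) p] by (simp add: K_def)
  qed
  ultimately show ?thesis
    using f lattice_clone_inf[OF f s] by blast
qed

text \<open>Systems of equations have to be finite; this makes the set of all equations valid on
  \<open>T\<close> a system.\<close>

lemma finite_nary: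
  assumes "C \<subseteq> all_operations"
  shows "finite (nary C n :: ('a::finite list \<Rightarrow> 'a) set)"
proof (rule finite_subset)
  show "nary C n \<subseteq> tuples n \<rightarrow>\<^sub>E UNIV"
    using assms by (auto simp: nary_def all_operations_def PiE_def)
  have "finite (tuples n :: 'a list set)"
    using finite_lists_length_eq[of "UNIV :: 'a set" n] by (simp add: tuples_def)
  then show "finite ((tuples n :: 'a list set) \<rightarrow>\<^sub>E (UNIV :: 'a set))"
    by (intro finite_PiE) auto
qed

lemma lattice_SDC_if_boolean_lattice:
  assumes "boolean_lattice TYPE('a::{finite,lattice})"
  shows "lattice_SDC TYPE('a)"
  unfolding lattice_SDC_def SDC_def
proof (intro allI impI iffI)
  fix n and T :: "'a list set"
  assume T: "T \<subseteq> tuples n" "T \<noteq> {}"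
  show "closed_under n T (centralizer lattice_clone)"
    if "\<exists>E. equation_system lattice_clone n E \<and> T = Sol n E"
    using that closed_under_Sol by blast
  assume closed: "closed_under n T (centralizer lattice_clone)"
  let ?N = "nary (lattice_clone :: 'a operation set) n"
  \<comment> \<open>The largest candidate: all equations valid on \<open>T\<close>. Separation
    excludes every solution outside \<open>T\<close>.\<close>
  let ?E = "{(f, g) \<in> ?N \<times> ?N. \<forall>t\<in>T. f t = g t}"
  have "finite (?N \<times> ?N)"
    using finite_nary is_clone_lattice_clone by (auto simp: is_clone_def)
  then have "equation_system lattice_clone n ?E"
    unfolding equation_system_def by (auto intro: finite_subset)
  moreover have "T = Sol n ?E"
  proof
    show "T \<subseteq> Sol n ?E" using T(1) by (auto simp: Sol_def)
    show "Sol n ?E \<subseteq> T"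
    proof
      fix a assume "a \<in> Sol n ?E"
      then show "a \<in> T"
        using boolean_lattice_separation[OF assms T closed, of a] by (auto simp: Sol_def)
    qed
  qed
  ultimately show "\<exists>E. equation_system lattice_clone n E \<and> T = Sol n E" by blast
qed

theorem theorem4p8:
  assumes "2 \<le> card (UNIV :: 'a::{finite,lattice} set)"
  shows "lattice_SDC TYPE('a) \<longleftrightarrow> boolean_lattice TYPE('a)"
  using boolean_lattice_if_lattice_SDC lattice_SDC_if_boolean_lattice by blast

end
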